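(* The axiom system IDFNL is sound and weakly complete for the $\mathcal{L}_1$-theory of all Došen frames: for all $\mathcal{L}_1$-formulas $A,B$, the sequent $A\vdash B$ is derivable in IDFNL iff it is valid in every Došen frame.
   Context: A Došen frame is $\langle S,R\rangle$ with $S$ non-empty and $R\subseteq S^3$; a model adds $V$ mapping propositional variables to subsets of $S$. $\mathcal{L}_1$-formulas: variables, $\top,\bot$, binary $\backslash,\bullet,/,\backslash\!\!\backslash,/\!\!/,\land,\lor$. Satisfaction: $s\vDash p$ iff $s\in V(p)$; $\top$ everywhere, $\bot$ nowhere; $\land,\lor$ classical; $s\vDash A\bullet B$ iff there are $t,u$ with $Rtus$, $t\vDash A$, $u\vDash B$; $s\vDash A\backslash B$ iff for all $t,u$, $Rtsu$ and $t\vDash A$ imply $u\vDash B$; $s\vDash B/A$ iff for all $t,u$, $Rstu$ and $t\vDash A$ imply $u\vDash B$; $s\vDash A\backslash\!\!\backslash B$ iff for all $t$ and all paths $\bar{x}=\langle x_1,\ldots,x_n\rangle$ ($n\ge1$) with every $x_i\vDash A$ and $R\overleftarrow{x}st$, $t\vDash B$; $s\vDash B/\!\!/A$ iff for all $t$ and such paths with $Rs\overrightarrow{x}t$, $t\vDash B$. Here $R\overleftarrow{x}st$: exist $y_1,\ldots,y_{n-1}$ with $Rx_1sy_1$, $Rx_{i+1}y_iy_{i+1}$ ($1\le i\le n-2$), $Rx_ny_{n-1}t$ (for $n=1$: $Rx_1st$); $Rs\overrightarrow{x}t$: exist $y_1,\ldots,y_{n-1}$ with $Rsx_1y_1$, $Ry_ix_{i+1}y_{i+1}$,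 $Ry_{n-1}x_nt$ (for $n=1$: $Rsx_1t$). $A\vdash B$ is valid in a frame iff in every model on it every state satisfying $A$ satisfies $B$. IDFNL derives sequents $A\vdash B$ from: axioms $A\vdash A$, $A\vdash\top$, $\bot\vdash A$, $A\land B\vdash A$, $A\land B\vdash B$, $A\vdash A\lor B$, $B\vdash A\lor B$, $A\land(B\lor C)\vdash(A\land B)\lor(A\land C)$; rules: from $A\vdash B,A\vdash C$ infer $A\vdash B\land C$; from $A\vdash C,B\vdash C$ infer $A\lor B\vdash C$; from $A\vdash B,B\vdash C$ infer $A\vdash C$; residuation rules: from $A\bullet B\vdash C$ infer $B\vdash A\backslash C$ and conversely, from $A\bullet B\vdash C$ infer $A\vdash C/B$ and conversely; iteration axioms $A\backslash\!\!\backslash B\land A\backslash\!\!\backslash C\vdash A\backslash\!\!\backslash(B\land C)$, $A\backslash\!\!\backslash B\vdash A\backslash B\land A\backslash(A\backslash\!\!\backslash B)$, $A\backslash B\land A\backslash(A\backslash\!\!\backslash B)\vdash A\backslash\!\!\backslash B$, $B/\!\!/A\land C/\!\!/A\vdash(B\land C)/\!\!/A$, $B/\!\!/A\vdash B/A\land(B/\!\!/A)/A$, $(B/\!\!/A)/A\land B/A\vdash B/\!\!/A$; iteration rules: from $A\vdash B$ and $C\vdash D$ infer $B\backslash\!\!\backslash C\vdash A\backslash\!\!\backslash D$ and $C/\!\!/B\vdash D/\!\!/A$; from $A\vdash B\backslash A$ infer $A\vdash B\backslash\!\!\backslash A$; from $A\vdash A/B$ infer $A\vdash A/\!\!/B$.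 *)

theory Defs
  imports Main
begin

(* In both right divisions the numerator comes first: B / A is RDiv B A. *)
datatype 'p fm =
    Var 'p
  | Top
  | Bot
  | LDiv "'p fm" "'p fm"    (infixr \<open>\<^bold>\<setminus>\<close> 70)
  | Prod "'p fm" "'p fm"    (infixl \<open>\<^bold>\<cdot>\<close> 70)
  | RDiv "'p fm" "'p fm"    (infixl \<open>\<^bold>'/\<close> 70)
  | ItLDiv "'p fm" "'p fm"  (infixr \<open>\<^bold>\<setminus>\<^bold>\<setminus>\<close> 70)
  | ItRDiv "'p fm" "'p fm"  (infixl \<open>\<^bold>'/\<^bold>'/\<close> 70)
  | Conj "'p fm" "'p fm"    (infixr \<open>\<^bold>\<and>\<close> 65)
  | Disj "'p fm" "'p fm"    (infixr \<open>\<^bold>\<or>\<close> 60)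

definition dosen_frame :: "'s set \<Rightarrow> ('s \<times> 's \<times> 's) set \<Rightarrow> bool" where
  "dosen_frame S R \<longleftrightarrow> S \<noteq> {} \<and> R \<subseteq> S \<times> S \<times> S"

definition dosen_model :: "'s set \<Rightarrow> ('s \<times> 's \<times> 's) set \<Rightarrow> ('p \<Rightarrow> 's set) \<Rightarrow> bool" where
  "dosen_model S R V \<longleftrightarrow> dosen_frame S R \<and> (\<forall>p. V p \<subseteq> S)"

(* The relation R x1...xn s t, with the path read leftwards. The intermediate states
   y 1, ..., y (n - 1) are extended by y 0 = s and y n = t, so that n = 1 needs no separate
   clause. The list xs is 0-based: xs ! i is the (i + 1)-st state of the path. *)
definition path_left :: "('s \<times> 's \<times> 's) set \<Rightarrow> 's list \<Rightarrow> 's \<Rightarrow> 's \<Rightarrow> bool" where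
  "path_left R xs s t \<longleftrightarrow>
     (\<exists>y. y 0 = s \<and> y (length xs) = t \<and> (\<forall>i<length xs. (xs ! i, y i, y (Suc i)) \<in> R))"

(* The relation R s x1...xn t, with the path read rightwards; same indexing. *)
definition path_right :: "('s \<times> 's \<times> 's) set \<Rightarrow> 's \<Rightarrow> 's list \<Rightarrow> 's \<Rightarrow> bool" where
  "path_right R s xs t \<longleftrightarrow>
     (\<exists>y. y 0 = s \<and> y (length xs) = t \<and> (\<forall>i<length xs. (y i, xs ! i, y (Suc i)) \<in> R))"

primrec sat :: "'s set \<Rightarrow> ('s \<times> 's \<times> 's) set \<Rightarrow> ('p \<Rightarrow> 's set) \<Rightarrow> 's \<Rightarrow> 'p fm \<Rightarrow> bool" where
  "sat S R V s (Var p) \<longleftrightarrow> s \<in> V p"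
| "sat S R V s Top \<longleftrightarrow> True"
| "sat S R V s Bot \<longleftrightarrow> False"
| "sat S R V s (A \<^bold>\<setminus> B) \<longleftrightarrow>
     (\<forall>t\<in>S. \<forall>u\<in>S. (t, s, u) \<in> R \<and> sat S R V t A \<longrightarrow> sat S R V u B)"
| "sat S R V s (A \<^bold>\<cdot> B) \<longleftrightarrow>
     (\<exists>t\<in>S. \<exists>u\<in>S. (t, u, s) \<in> R \<and> sat S R V t A \<and> sat S R V u B)"
| "sat S R V s (B \<^bold>/ A) \<longleftrightarrow>
     (\<forall>t\<in>S. \<forall>u\<in>S. (s, t, u) \<in> R \<and> sat S R V t A \<longrightarrow> sat S R V u B)"
| "sat S R V s (A \<^bold>\<setminus>\<^bold>\<setminus> B) \<longleftrightarrow>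
     (\<forall>t\<in>S. \<forall>xs. xs \<noteq> [] \<and> set xs \<subseteq> S \<and> (\<forall>x\<in>set xs. sat S R V x A) \<and> path_left R xs s t
        \<longrightarrow> sat S R V t B)"
| "sat S R V s (B \<^bold>/\<^bold>/ A) \<longleftrightarrow>
     (\<forall>t\<in>S. \<forall>xs. xs \<noteq> [] \<and> set xs \<subseteq> S \<and> (\<forall>x\<in>set xs. sat S R V x A) \<and> path_right R s xs t
        \<longrightarrow> sat S R V t B)"
| "sat S R V s (A \<^bold>\<and> B) \<longleftrightarrow> sat S R V s A \<and> sat S R V s B"
| "sat S R V s (A \<^bold>\<or> B) \<longleftrightarrow> sat S R V s A \<or> sat S R V s B"

definition valid_in :: "'s set \<Rightarrow> ('s \<times> 's \<times> 's) set \<Rightarrow> 'p fm \<Rightarrow> 'p fm \<Rightarrow> bool" where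
  "valid_in S R A B \<longleftrightarrow>
     (\<forall>V. dosen_model S R V \<longrightarrow> (\<forall>s\<in>S. sat S R V s A \<longrightarrow> sat S R V s B))"

inductive IDFNL :: "'p fm \<Rightarrow> 'p fm \<Rightarrow> bool" (infix \<open>\<turnstile>\<close> 50) where
  ax_id: "A \<turnstile> A"
| ax_top: "A \<turnstile> Top"
| ax_bot: "Bot \<turnstile> A"
| ax_conj1: "A \<^bold>\<and> B \<turnstile> A"
| ax_conj2: "A \<^bold>\<and> B \<turnstile> B"
| ax_disj1: "A \<turnstile> A \<^bold>\<or> B"
| ax_disj2: "B \<turnstile> A \<^bold>\<or> B"
| ax_distr: "A \<^bold>\<and> (B \<^bold>\<or> C) \<turnstile> (A \<^bold>\<and> B) \<^bold>\<or> (A \<^bold>\<and> C)"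
| conjR: "\<lbrakk>A \<turnstile> B; A \<turnstile> C\<rbrakk> \<Longrightarrow> A \<turnstile> B \<^bold>\<and> C"
| disjL: "\<lbrakk>A \<turnstile> C; B \<turnstile> C\<rbrakk> \<Longrightarrow> A \<^bold>\<or> B \<turnstile> C"
| cut: "\<lbrakk>A \<turnstile> B; B \<turnstile> C\<rbrakk> \<Longrightarrow> A \<turnstile> C"
| resL: "A \<^bold>\<cdot> B \<turnstile> C \<Longrightarrow> B \<turnstile> A \<^bold>\<setminus> C"
| resL_conv: "B \<turnstile> A \<^bold>\<setminus> C \<Longrightarrow> A \<^bold>\<cdot> B \<turnstile> C"
| resR: "A \<^bold>\<cdot> B \<turnstile> C \<Longrightarrow> A \<turnstile> C \<^bold>/ B"
| resR_conv: "A \<turnstile> C \<^bold>/ B \<Longrightarrow> A \<^bold>\<cdot> B \<turnstile> C"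
| itL_conj: "(A \<^bold>\<setminus>\<^bold>\<setminus> B) \<^bold>\<and> (A \<^bold>\<setminus>\<^bold>\<setminus> C) \<turnstile> A \<^bold>\<setminus>\<^bold>\<setminus> (B \<^bold>\<and> C)"
| itL_unfold: "A \<^bold>\<setminus>\<^bold>\<setminus> B \<turnstile> (A \<^bold>\<setminus> B) \<^bold>\<and> (A \<^bold>\<setminus> (A \<^bold>\<setminus>\<^bold>\<setminus> B))"
| itL_fold: "(A \<^bold>\<setminus> B) \<^bold>\<and> (A \<^bold>\<setminus> (A \<^bold>\<setminus>\<^bold>\<setminus> B)) \<turnstile> A \<^bold>\<setminus>\<^bold>\<setminus> B"
| itR_conj: "(B \<^bold>/\<^bold>/ A) \<^bold>\<and> (C \<^bold>/\<^bold>/ A) \<turnstile> (B \<^bold>\<and> C) \<^bold>/\<^bold>/ A"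
| itR_unfold: "B \<^bold>/\<^bold>/ A \<turnstile> (B \<^bold>/ A) \<^bold>\<and> ((B \<^bold>/\<^bold>/ A) \<^bold>/ A)"
| itR_fold: "((B \<^bold>/\<^bold>/ A) \<^bold>/ A) \<^bold>\<and> (B \<^bold>/ A) \<turnstile> B \<^bold>/\<^bold>/ A"
| itL_mono: "\<lbrakk>A \<turnstile> B; C \<turnstile> D\<rbrakk> \<Longrightarrow> B \<^bold>\<setminus>\<^bold>\<setminus> C \<turnstile> A \<^bold>\<setminus>\<^bold>\<setminus> D"
| itR_mono: "\<lbrakk>A \<turnstile> B; C \<turnstile> D\<rbrakk> \<Longrightarrow> C \<^bold>/\<^bold>/ B \<turnstile> D \<^bold>/\<^bold>/ A"
| itL_ind: "A \<turnstile> B \<^bold>\<setminus> A \<Longrightarrow> A \<turnstile> B \<^bold>\<setminus>\<^bold>\<setminus> A"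
| itR_ind: "A \<turnstile> A \<^bold>/ B \<Longrightarrow> A \<turnstile> A \<^bold>/\<^bold>/ B"

end

theory Submission
  imports Defs
begin

text \<open>
  Completeness is proved by a finite canonical model.  Fix a finite set \<open>G\<close> of formulas closed
  under subformulas.  A world is a set \<open>t \<subseteq> G\<close> such that \<open>\<And>t \<turnstile> \<Or>(G - t)\<close> is not derivable, and
  \<open>(t, u, v)\<close> is in the ternary relation iff \<open>\<And>t \<cdot> \<And>u \<turnstile> \<Or>(G - v)\<close> is not derivable.  Since \<open>G\<close> is
  finite, distributivity alone extends every underivable sequent to a world.  In the truth lemma
  for an iterated division, the set \<open>X\<close> of worlds satisfying \<open>A \<setminus>\<setminus> B\<close> is finite, hence described by
  the formula \<open>\<phi> = \<Or>{\<And>s | s \<in> X}\<close>.  Every world reached from \<open>X\<close> by a step along \<open>A\<close> is again in \<open>X\<close>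
  and satisfies \<open>B\<close>, which gives \<open>A \<cdot> \<phi> \<turnstile> \<phi> \<and> B\<close>, and the induction rule yields
  \<open>\<phi> \<turnstile> A \<setminus>\<setminus> B\<close>.
\<close>

section \<open>Paths and iterated divisions\<close>

lemma path_left_Nil: "path_left R [] s t \<longleftrightarrow> s = t"
  unfolding path_left_def by auto

lemma path_left_Cons:
  "path_left R (x # xs) s t \<longleftrightarrow> (\<exists>y. (x, s, y) \<in> R \<and> path_left R xs y t)"
proof
  assume "path_left R (x # xs) s t"
  then obtain y where y: "y 0 = s" "y (Suc (length xs)) = t"
      "\<And>i. i < Suc (length xs) \<Longrightarrow> ((x # xs) ! i, y i, y (Suc i)) \<in> R"
    unfolding path_left_def by auto
  have "(x, s, y (Suc 0)) \<in> R" using y(3)[of 0] y(1) by simp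
  moreover have "path_left R xs (y (Suc 0)) t"
    unfolding path_left_def using y(2) y(3)[of "Suc _"]
    by (intro exI[of _ "\<lambda>i. y (Suc i)"]) auto
  ultimately show "\<exists>y. (x, s, y) \<in> R \<and> path_left R xs y t" by blast
next
  assume "\<exists>y. (x, s, y) \<in> R \<and> path_left R xs y t"
  then obtain y where y: "(x, s, y 0) \<in> R" "y (length xs) = t"
      "\<And>i. i < length xs \<Longrightarrow> (xs ! i, y i, y (Suc i)) \<in> R"
    unfolding path_left_def by auto
  show "path_left R (x # xs) s t"
    \<comment> \<open>The intermediate states are shifted by one place and \<open>s\<close> becomes
      the new state number 0.\<close>
    unfolding path_left_def using y
    by (intro exI[of _ "\<lambda>i. case i of 0 \<Rightarrow> s | Suc j \<Rightarrow> y j"]) (auto simp: less_Suc_eq_0_disj)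
qed

text \<open>Swapping the first two arguments of \<open>R\<close> reverses the side on which a path
  acts, so facts about left paths transfer to right paths.\<close>

lemma path_right_eq_path_left:
  "path_right R s xs t \<longleftrightarrow> path_left {(x, y, z). (y, x, z) \<in> R} xs s t"
  unfolding path_right_def path_left_def by simp

lemma path_right_Nil: "path_right R s [] t \<longleftrightarrow> s = t"
  by (simp add: path_right_eq_path_left path_left_Nil)

lemma path_right_Cons:
  "path_right R s (x # xs) t \<longleftrightarrow> (\<exists>y. (s, x, y) \<in> R \<and> path_right R y xs t)"
  by (simp add: path_right_eq_path_left path_left_Cons)

text \<open>\<open>P\<close> is carried along the path as an invariant, and each step also lands in
  \<open>Q\<close>. The start \<open>s\<close> need not lie in \<open>Q\<close>, hence the path must
  have at least one step.\<close>

lemma path_left_invariant: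
  assumes "path_left R xs s t" "xs \<noteq> []" "s \<in> P"
    and "\<And>x y z. x \<in> set xs \<Longrightarrow> (x, y, z) \<in> R \<Longrightarrow> y \<in> P \<Longrightarrow> z \<in> P \<and> z \<in> Q"
  shows "t \<in> Q"
  using assms
proof (induction xs arbitrary: s)
  case Nil
  then show ?case by simp
next
  case (Cons x xs)
  then obtain y where y: "(x, s, y) \<in> R" "path_left R xs y t"
    by (auto simp: path_left_Cons)
  have yPQ: "y \<in> P \<and> y \<in> Q" using Cons.prems(3) Cons.prems(4)[of x s y] y(1) by simp
  show ?case
  proof (cases "xs = []")
    case True
    then show ?thesis using y(2) yPQ by (simp add: path_left_Nil)
  next
    case False
    show ?thesis
      by (rule Cons.IH[OF y(2) False]) (use yPQ Cons.prems(4) in auto)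
  qed
qed

lemmas path_right_invariant =
  path_left_invariant[of "{(x, y, z). (y, x, z) \<in> R}" for R,
    folded path_right_eq_path_left, simplified]

text \<open>Splitting a path after its first state shows that the iterated division is a fixed point
  of \<open>X = LDiv A B \<and> LDiv A X\<close>. This allows later arguments to go one step at a
  time. A one-element path accounts for the part with \<open>B\<close>, a longer one for the
  rest.\<close>

lemma sat_ItLDiv_unfold:
  assumes "dosen_frame S R" "s \<in> S"
  shows "sat S R V s (A \<^bold>\<setminus>\<^bold>\<setminus> B) \<longleftrightarrow>
    (\<forall>t u. (t, s, u) \<in> R \<longrightarrow> sat S R V t A \<longrightarrow> sat S R V u B \<and> sat S R V u (A \<^bold>\<setminus>\<^bold>\<setminus> B))"
    (is "?L \<longleftrightarrow> ?R")
proof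
  have R: "\<And>t u v. (t, u, v) \<in> R \<Longrightarrow> t \<in> S \<and> u \<in> S \<and> v \<in> S"
    using assms unfolding dosen_frame_def by auto
  assume *: ?L
  have L: "sat S R V w B"
    if "w \<in> S" "xs \<noteq> []" "set xs \<subseteq> S" "\<forall>x\<in>set xs. sat S R V x A" "path_left R xs s w" for w xs
    using *[unfolded sat.simps, rule_format, of w xs] that by simp
  show ?R
  proof (intro allI impI conjI)
    fix t u assume t: "(t, s, u) \<in> R" "sat S R V t A"
    show "sat S R V u B"
      using R[OF t(1)] t by (intro L[of u "[t]"]) (auto simp: path_left_Cons path_left_Nil)
    show "sat S R V u (A \<^bold>\<setminus>\<^bold>\<setminus> B)"
      unfolding sat.simps
    proof (intro ballI allI impI)
      fix w xs
      assume "w \<in> S"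
        and xs: "xs \<noteq> [] \<and> set xs \<subseteq> S \<and> (\<forall>x\<in>set xs. sat S R V x A) \<and> path_left R xs u w"
      then show "sat S R V w B"
        using R[OF t(1)] t by (intro L[of w "t # xs"]) (auto simp: path_left_Cons)
    qed
  qed
next
  assume ?R
  show ?L
    unfolding sat.simps
  proof (intro ballI allI impI)
    fix w xs
    assume "w \<in> S"
      and xs: "xs \<noteq> [] \<and> set xs \<subseteq> S \<and> (\<forall>x\<in>set xs. sat S R V x A) \<and> path_left R xs s w"
    then obtain x xs' y where [simp]: "xs = x # xs'" and y: "(x, s, y) \<in> R" "path_left R xs' y w"
      by (cases xs) (auto simp: path_left_Cons)
    have *: "sat S R V y B" "sat S R V y (A \<^bold>\<setminus>\<^bold>\<setminus> B)"
      using \<open>?R\<close>[rule_format, OF y(1)] xs by simp_all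
    show "sat S R V w B"
    proof (cases "xs' = []")
      case True
      then show ?thesis using y(2) *(1) by (simp add: path_left_Nil)
    next
      case False
      then show ?thesis
        using *(2)[unfolded sat.simps, rule_format, of w xs'] \<open>w \<in> S\<close> xs y(2) by simp
    qed
  qed
qed

lemma sat_ItRDiv_unfold:
  assumes "dosen_frame S R" "s \<in> S"
  shows "sat S R V s (B \<^bold>/\<^bold>/ A) \<longleftrightarrow>
    (\<forall>t u. (s, t, u) \<in> R \<longrightarrow> sat S R V t A \<longrightarrow> sat S R V u B \<and> sat S R V u (B \<^bold>/\<^bold>/ A))"
    (is "?L \<longleftrightarrow> ?R")
proof
  have R: "\<And>t u v. (t, u, v) \<in> R \<Longrightarrow> t \<in> S \<and> u \<in> S \<and> v \<in> S"
    using assms unfolding dosen_frame_def by auto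
  assume *: ?L
  have L: "sat S R V w B"
    if "w \<in> S" "xs \<noteq> []" "set xs \<subseteq> S" "\<forall>x\<in>set xs. sat S R V x A" "path_right R s xs w" for w xs
    using *[unfolded sat.simps, rule_format, of w xs] that by simp
  show ?R
  proof (intro allI impI conjI)
    fix t u assume t: "(s, t, u) \<in> R" "sat S R V t A"
    show "sat S R V u B"
      using R[OF t(1)] t by (intro L[of u "[t]"]) (auto simp: path_right_Cons path_right_Nil)
    show "sat S R V u (B \<^bold>/\<^bold>/ A)"
      unfolding sat.simps
    proof (intro ballI allI impI)
      fix w xs
      assume "w \<in> S"
        and xs: "xs \<noteq> [] \<and> set xs \<subseteq> S \<and> (\<forall>x\<in>set xs. sat S R V x A) \<and> path_right R u xs w"
      then show "sat S R V w B"
        using R[OF t(1)] t by (intro L[of w "t # xs"]) (auto simp: path_right_Cons)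
    qed
  qed
next
  assume ?R
  show ?L
    unfolding sat.simps
  proof (intro ballI allI impI)
    fix w xs
    assume "w \<in> S"
      and xs: "xs \<noteq> [] \<and> set xs \<subseteq> S \<and> (\<forall>x\<in>set xs. sat S R V x A) \<and> path_right R s xs w"
    then obtain x xs' y where [simp]: "xs = x # xs'" and y: "(s, x, y) \<in> R" "path_right R y xs' w"
      by (cases xs) (auto simp: path_right_Cons)
    have *: "sat S R V y B" "sat S R V y (B \<^bold>/\<^bold>/ A)"
      using \<open>?R\<close>[rule_format, OF y(1)] xs by simp_all
    show "sat S R V w B"
    proof (cases "xs' = []")
      case True
      then show ?thesis using y(2) *(1) by (simp add: path_right_Nil)
    next
      case False
      then show ?thesis
        using *(2)[unfolded sat.simps, rule_format, of w xs'] \<open>w \<in> S\<close> xs y(2) by simp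
    qed
  qed
qed

text \<open>Together with the unfolding this makes the iterated division the greatest fixed point:
  any set closed under steps along \<open>A\<close>, with all results of such steps satisfying
  \<open>B\<close>, consists of states satisfying it.\<close>

lemma sat_ItLDiv_coinduct:
  assumes "s \<in> P"
    and "\<And>t s' u. (t, s', u) \<in> R \<Longrightarrow> s' \<in> P \<Longrightarrow> sat S R V t A \<Longrightarrow> u \<in> P \<and> sat S R V u B"
  shows "sat S R V s (A \<^bold>\<setminus>\<^bold>\<setminus> B)"
  unfolding sat.simps
proof (intro ballI allI impI)
  fix t xs
  assume "xs \<noteq> [] \<and> set xs \<subseteq> S \<and> (\<forall>x\<in>set xs. sat S R V x A) \<and> path_left R xs s t"
  then have "t \<in> {u. sat S R V u B}"
    using assms by (intro path_left_invariant[of R xs s t P]) auto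
  then show "sat S R V t B" by simp
qed

lemma sat_ItRDiv_coinduct:
  assumes "s \<in> P"
    and "\<And>t s' u. (s', t, u) \<in> R \<Longrightarrow> s' \<in> P \<Longrightarrow> sat S R V t A \<Longrightarrow> u \<in> P \<and> sat S R V u B"
  shows "sat S R V s (B \<^bold>/\<^bold>/ A)"
  unfolding sat.simps
proof (intro ballI allI impI)
  fix t xs
  assume "xs \<noteq> [] \<and> set xs \<subseteq> S \<and> (\<forall>x\<in>set xs. sat S R V x A) \<and> path_right R s xs t"
  then have "t \<in> {u. sat S R V u B}"
    using assms by (intro path_right_invariant[of R s xs t P]) auto
  then show "sat S R V t B" by simp
qed

section \<open>Soundness\<close>

text \<open>The fold and unfold axioms are the two directions of the fixed point equation, and the
  induction rules are instances of coinduction. Everything else follows from the satisfaction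
  clauses.\<close>

lemma soundness:
  assumes "A \<turnstile> B" and frame: "dosen_frame S R"
  shows "s \<in> S \<Longrightarrow> sat S R V s A \<Longrightarrow> sat S R V s B"
  using assms(1)
proof (induction arbitrary: s rule: IDFNL.induct)
  case (itL_unfold A B)
  then show ?case
    using sat_ItLDiv_unfold[OF frame itL_unfold(1), of V A B]
    \<comment> \<open>The path clause is kept folded, so that the iterated division is treated as an
      atom in the fixed point equation.\<close>
    by (simp del: sat.simps(7)) blast
next
  case (itR_unfold B A)
  then show ?case
    using sat_ItRDiv_unfold[OF frame itR_unfold(1), of V B A]
    by (simp del: sat.simps(8)) blast
next
  case (itL_fold A B)
  have "\<And>t u v. (t, u, v) \<in> R \<Longrightarrow> t \<in> S \<and> u \<in> S \<and> v \<in> S"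
    using frame unfolding dosen_frame_def by auto
  with itL_fold show ?case
    unfolding sat_ItLDiv_unfold[OF frame itL_fold(1), of V A B]
    by (simp del: sat.simps(7)) blast
next
  case (itR_fold B A)
  have "\<And>t u v. (t, u, v) \<in> R \<Longrightarrow> t \<in> S \<and> u \<in> S \<and> v \<in> S"
    using frame unfolding dosen_frame_def by auto
  with itR_fold show ?case
    unfolding sat_ItRDiv_unfold[OF frame itR_fold(1), of V B A]
    by (simp del: sat.simps(8)) blast
next
  case (itL_ind A B)
  \<comment> \<open>By the induction hypothesis the truth set of \<open>A\<close> is closed under
    steps along \<open>B\<close>. It therefore serves both as the invariant and as the set to be
    reached.\<close>
  show ?case
    by (rule sat_ItLDiv_coinduct[of _ "{s \<in> S. sat S R V s A}"])
      (use itL_ind frame in \<open>auto simp: dosen_frame_def\<close>)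
next
  case (itR_ind A B)
  show ?case
    by (rule sat_ItRDiv_coinduct[of _ "{s \<in> S. sat S R V s A}"])
      (use itR_ind frame in \<open>auto simp: dosen_frame_def\<close>)
next
  case (itL_mono A B C D)
  then show ?case unfolding sat.simps by (meson subsetD)
next
  case (itR_mono A B C D)
  then show ?case unfolding sat.simps by (meson subsetD)
next
  case (resL A B C)
  then show ?case unfolding sat.simps by meson
next
  case (resL_conv B A C)
  then show ?case unfolding sat.simps by meson
next
  case (resR A B C)
  then show ?case unfolding sat.simps by meson
next
  case (resR_conv A C B)
  then show ?case unfolding sat.simps by meson
next
  case (itL_conj A B C)
  then show ?case unfolding sat.simps by meson
next
  case (itR_conj B A C)
  then show ?case unfolding sat.simps by meson
qed auto

section \<open>Derived rules and finite meets and joins\<close>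

text \<open>Residuation isolates one factor at a time to the left of \<turnstile>, where
  \<open>cut\<close> can replace it.\<close>

lemma Prod_mono: "A \<turnstile> A' \<Longrightarrow> B \<turnstile> B' \<Longrightarrow> A \<^bold>\<cdot> B \<turnstile> A' \<^bold>\<cdot> B'"
  by (rule resR_conv, erule cut, rule resR, rule resL_conv, erule cut, rule resL, rule ax_id)

lemma LDiv_mono: "B \<turnstile> C \<Longrightarrow> A \<^bold>\<setminus> B \<turnstile> A \<^bold>\<setminus> C"
  by (rule resL, rule cut[OF resL_conv[OF ax_id]])

lemma RDiv_mono: "B \<turnstile> C \<Longrightarrow> B \<^bold>/ A \<turnstile> C \<^bold>/ A"
  by (rule resR, rule cut[OF resR_conv[OF ax_id]])

lemma derives_LDiv_iff: "B \<turnstile> A \<^bold>\<setminus> C \<longleftrightarrow> A \<^bold>\<cdot> B \<turnstile> C"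
  using resL resL_conv by (rule iffI[rotated])

lemma derives_RDiv_iff: "A \<turnstile> C \<^bold>/ B \<longleftrightarrow> A \<^bold>\<cdot> B \<turnstile> C"
  using resR resR_conv by (rule iffI[rotated])

lemma derives_Conj_iff: "D \<turnstile> A \<^bold>\<and> B \<longleftrightarrow> D \<turnstile> A \<and> D \<turnstile> B"
  using conjR cut[OF _ ax_conj1] cut[OF _ ax_conj2] by blast

lemma Disj_derives_iff: "A \<^bold>\<or> B \<turnstile> D \<longleftrightarrow> A \<turnstile> D \<and> B \<turnstile> D"
  using disjL cut[OF ax_disj1] cut[OF ax_disj2] by blast

text \<open>Read contrapositively: when \<open>C\<close> does not derive \<open>D\<close>, any
  formula \<open>E\<close> can be added to the left or to the right of the sequent without making it
  derivable. This is what distributivity contributes to the construction of worlds.\<close>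

lemma distributive_cut:
  assumes "C \<^bold>\<and> E \<turnstile> D" "C \<turnstile> D \<^bold>\<or> E"
  shows "C \<turnstile> D"
proof -
  have "C \<turnstile> C \<^bold>\<and> (D \<^bold>\<or> E)" using assms(2) by (intro conjR ax_id)
  then have "C \<turnstile> (C \<^bold>\<and> D) \<^bold>\<or> (C \<^bold>\<and> E)" by (rule cut[OF _ ax_distr])
  moreover have "(C \<^bold>\<and> D) \<^bold>\<or> (C \<^bold>\<and> E) \<turnstile> D"
    using assms(1) by (intro disjL ax_conj2)
  ultimately show ?thesis by (rule cut)
qed

text \<open>The induction rule needs the same formula as premise and as consequent. It is applied to
  \<open>?D\<close>, which is invariant and also entails \<open>B\<close>. Since \<open>C\<close>
  itself may fail to entail \<open>B\<close>, this covers only the paths from \<open>?D\<close>; one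
  step along \<open>A\<close> leads from \<open>C\<close> to \<open>?D\<close>, and the fold axiom
  adds this step.\<close>

lemma itL_intro:
  assumes "A \<^bold>\<cdot> C \<turnstile> C \<^bold>\<and> B"
  shows "C \<turnstile> A \<^bold>\<setminus>\<^bold>\<setminus> B"
proof -
  let ?D = "C \<^bold>\<and> B"
  have CD: "C \<turnstile> A \<^bold>\<setminus> ?D" using assms by (rule resL)
  then have "?D \<turnstile> A \<^bold>\<setminus>\<^bold>\<setminus> ?D" by (intro itL_ind cut[OF ax_conj1])
  then have "?D \<turnstile> A \<^bold>\<setminus>\<^bold>\<setminus> B" by (rule cut) (intro itL_mono ax_id ax_conj2)
  then have "C \<turnstile> (A \<^bold>\<setminus> B) \<^bold>\<and> (A \<^bold>\<setminus> (A \<^bold>\<setminus>\<^bold>\<setminus> B))"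
    by (intro conjR cut[OF CD] LDiv_mono ax_conj2)
  then show ?thesis by (rule cut) (rule itL_fold)
qed

lemma itR_intro:
  assumes "C \<^bold>\<cdot> A \<turnstile> C \<^bold>\<and> B"
  shows "C \<turnstile> B \<^bold>/\<^bold>/ A"
proof -
  let ?D = "C \<^bold>\<and> B"
  have CD: "C \<turnstile> ?D \<^bold>/ A" using assms by (rule resR)
  then have "?D \<turnstile> ?D \<^bold>/\<^bold>/ A" by (intro itR_ind cut[OF ax_conj1])
  then have "?D \<turnstile> B \<^bold>/\<^bold>/ A" by (rule cut) (intro itR_mono ax_id ax_conj2)
  then have "C \<turnstile> ((B \<^bold>/\<^bold>/ A) \<^bold>/ A) \<^bold>\<and> (B \<^bold>/ A)"
    by (intro conjR cut[OF CD] RDiv_mono ax_conj2)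
  then show ?thesis by (rule cut) (rule itR_fold)
qed

text \<open>The choice is unique up to interderivability when the set is finite.\<close>

definition meet :: "'p fm set \<Rightarrow> 'p fm" where
  "meet T = (SOME C. \<forall>D. D \<turnstile> C \<longleftrightarrow> (\<forall>E\<in>T. D \<turnstile> E))"

definition join :: "'p fm set \<Rightarrow> 'p fm" where
  "join T = (SOME C. \<forall>D. C \<turnstile> D \<longleftrightarrow> (\<forall>E\<in>T. E \<turnstile> D))"

lemma derives_meet_iff:
  assumes "finite T"
  shows "D \<turnstile> meet T \<longleftrightarrow> (\<forall>E\<in>T. D \<turnstile> E)"
proof -
  have "\<exists>C. \<forall>D. D \<turnstile> C \<longleftrightarrow> (\<forall>E\<in>T. D \<turnstile> E)"
    using assms
  proof (induction T)
    case empty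
    show ?case by (rule exI[of _ Top]) (simp add: ax_top)
  next
    case (insert F T)
    then obtain C where C: "\<And>D. D \<turnstile> C \<longleftrightarrow> (\<forall>E\<in>T. D \<turnstile> E)" by auto
    show ?case by (intro exI[of _ "F \<^bold>\<and> C"]) (simp add: C derives_Conj_iff)
  qed
  then show ?thesis unfolding meet_def by (rule someI2_ex) blast
qed

lemma join_derives_iff:
  assumes "finite T"
  shows "join T \<turnstile> D \<longleftrightarrow> (\<forall>E\<in>T. E \<turnstile> D)"
proof -
  have "\<exists>C. \<forall>D. C \<turnstile> D \<longleftrightarrow> (\<forall>E\<in>T. E \<turnstile> D)"
    using assms
  proof (induction T)
    case empty
    show ?case by (rule exI[of _ Bot]) (simp add: ax_bot)
  next
    case (insert F T)
    then obtain C where C: "\<And>D. C \<turnstile> D \<longleftrightarrow> (\<forall>E\<in>T. E \<turnstile> D)" by auto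
    show ?case by (intro exI[of _ "F \<^bold>\<or> C"]) (simp add: C Disj_derives_iff)
  qed
  then show ?thesis unfolding join_def by (rule someI2_ex) blast
qed

lemma meet_derives: "finite T \<Longrightarrow> E \<in> T \<Longrightarrow> meet T \<turnstile> E"
  using derives_meet_iff ax_id by blast

lemma derives_join: "finite T \<Longrightarrow> E \<in> T \<Longrightarrow> E \<turnstile> join T"
  using join_derives_iff ax_id by blast

section \<open>Worlds\<close>

text \<open>These are the traces on \<open>G\<close> of the prime filters of the lattice of formulas
  modulo interderivability.\<close>

definition worlds :: "'p fm set \<Rightarrow> 'p fm set set" where
  "worlds G = {t. t \<subseteq> G \<and> \<not> meet t \<turnstile> join (G - t)}"

lemma finite_worlds: "finite G \<Longrightarrow> finite (worlds G)"
  unfolding worlds_def by (rule finite_subset[of _ "Pow G"]) auto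

text \<open>The formulas of \<open>G\<close> are placed one by one on either side of the underivable
  sequent. \<open>C\<close> and \<open>D\<close> stay as side formulas, since they need not belong
  to \<open>G\<close>.\<close>

lemma separating_split:
  assumes "finite G" "\<not> C \<turnstile> D"
  shows "\<exists>t\<subseteq>G. \<not> C \<^bold>\<and> meet t \<turnstile> D \<^bold>\<or> join (G - t)"
  using assms
proof (induction G)
  case empty
  have "C \<turnstile> C \<^bold>\<and> meet {}" by (intro conjR ax_id) (simp add: derives_meet_iff)
  moreover have "D \<^bold>\<or> join {} \<turnstile> D" by (intro disjL ax_id) (simp add: join_derives_iff)
  ultimately have "\<not> C \<^bold>\<and> meet {} \<turnstile> D \<^bold>\<or> join {}" using empty cut by metis
  then show ?case by simp
next
  case (insert E G)
  then obtain t where t: "t \<subseteq> G" and n: "\<not> C \<^bold>\<and> meet t \<turnstile> D \<^bold>\<or> join (G - t)" by blast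
  have fin: "finite t" using t insert.hyps(1) by (rule finite_subset)
  have finG: "finite (G - t)" using insert.hyps(1) by simp
  \<comment> \<open>At least one side can take \<open>E\<close>. The two cases put \<open>E\<close>
    into \<open>t\<close> or leave it in the complement.\<close>
  from n distributive_cut[of "C \<^bold>\<and> meet t" E "D \<^bold>\<or> join (G - t)"] consider
      "\<not> (C \<^bold>\<and> meet t) \<^bold>\<and> E \<turnstile> D \<^bold>\<or> join (G - t)"
    | "\<not> C \<^bold>\<and> meet t \<turnstile> (D \<^bold>\<or> join (G - t)) \<^bold>\<or> E"
    by blast
  then show ?case
  proof cases
    case 1
    have C: "(C \<^bold>\<and> meet t) \<^bold>\<and> E \<turnstile> C" "(C \<^bold>\<and> meet t) \<^bold>\<and> E \<turnstile> meet t"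
      by (rule cut[OF ax_conj1], rule ax_conj1 ax_conj2)+
    have "(C \<^bold>\<and> meet t) \<^bold>\<and> E \<turnstile> F" if "F \<in> t" for F
      using cut[OF C(2) meet_derives[OF fin that]] .
    then have "(C \<^bold>\<and> meet t) \<^bold>\<and> E \<turnstile> C \<^bold>\<and> meet (insert E t)"
      using fin C(1) ax_conj2 by (simp add: derives_Conj_iff derives_meet_iff)
    moreover have "insert E G - insert E t = G - t" using insert.hyps(2) by auto
    ultimately have "\<not> C \<^bold>\<and> meet (insert E t) \<turnstile> D \<^bold>\<or> join (insert E G - insert E t)"
      using 1 cut by metis
    then show ?thesis using t by (intro exI[of _ "insert E t"]) auto
  next
    case 2
    have "insert E G - t = insert E (G - t)" using insert.hyps(2) t by auto
    moreover have D: "D \<turnstile> (D \<^bold>\<or> join (G - t)) \<^bold>\<or> E" "join (G - t) \<turnstile> (D \<^bold>\<or> join (G - t)) \<^bold>\<or> E"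
      by (rule cut[OF _ ax_disj1], rule ax_disj1 ax_disj2)+
    have "F \<turnstile> (D \<^bold>\<or> join (G - t)) \<^bold>\<or> E" if "F \<in> G - t" for F
      using cut[OF derives_join[OF finG that] D(2)] .
    then have "D \<^bold>\<or> join (insert E (G - t)) \<turnstile> (D \<^bold>\<or> join (G - t)) \<^bold>\<or> E"
      using finG D(1) ax_disj2 by (simp add: Disj_derives_iff join_derives_iff)
    ultimately have "\<not> C \<^bold>\<and> meet t \<turnstile> D \<^bold>\<or> join (insert E G - t)"
      using 2 cut by metis
    then show ?thesis using t by (intro exI[of _ t]) auto
  qed
qed

text \<open>For \<open>C\<close> and \<open>D\<close> outside \<open>G\<close>, the last two
  conclusions stand in for \<open>C\<close> belonging to the world and \<open>D\<close> not
  belonging to it. Each conclusion is weaker than the single sequent given by the split.\<close>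

lemma separating_world:
  assumes "finite G" "\<not> C \<turnstile> D"
  obtains t where "t \<in> worlds G" "\<not> C \<turnstile> join (G - t)" "\<not> meet t \<turnstile> D"
proof -
  obtain t where t: "t \<subseteq> G" and n: "\<not> C \<^bold>\<and> meet t \<turnstile> D \<^bold>\<or> join (G - t)"
    using separating_split[OF assms] by blast
  show ?thesis
  proof (rule that[of t])
    show "t \<in> worlds G"
      unfolding worlds_def using t n cut[OF ax_conj2 cut[OF _ ax_disj2]] by blast
    show "\<not> C \<turnstile> join (G - t)" using n cut[OF ax_conj1 cut[OF _ ax_disj2]] by blast
    show "\<not> meet t \<turnstile> D" using n cut[OF ax_conj2 cut[OF _ ax_disj1]] by blast
  qed
qed

text \<open>Worlds are deductively closed within \<open>G\<close>: a derivable formula outside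
  \<open>t\<close> would be a disjunct of \<open>join (G - t)\<close>, which \<open>meet t\<close>
  does not derive.\<close>

lemma meet_derives_iff_mem:
  assumes "finite G" "t \<in> worlds G" "E \<in> G"
  shows "meet t \<turnstile> E \<longleftrightarrow> E \<in> t"
proof
  have t: "t \<subseteq> G" "\<not> meet t \<turnstile> join (G - t)" using assms(2) by (auto simp: worlds_def)
  show "E \<in> t" if "meet t \<turnstile> E"
  proof (rule ccontr)
    assume "E \<notin> t"
    then have "E \<turnstile> join (G - t)" using assms by (intro derives_join) auto
    then show False using cut[OF that] t(2) by blast
  qed
  show "meet t \<turnstile> E" if "E \<in> t"
    using that t(1) assms(1) by (intro meet_derives) (auto intro: finite_subset)
qed

lemma mem_if_not_derives_join:
  "finite G \<Longrightarrow> E \<in> G \<Longrightarrow> \<not> E \<turnstile> join (G - t) \<Longrightarrow> E \<in> t"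
  using derives_join[of "G - t" E] by auto

section \<open>The canonical model\<close>

primrec subfms :: "'p fm \<Rightarrow> 'p fm set" where
  "subfms (Var p) = {Var p}"
| "subfms Top = {Top}"
| "subfms Bot = {Bot}"
| "subfms (A \<^bold>\<setminus> B) = insert (A \<^bold>\<setminus> B) (subfms A \<union> subfms B)"
| "subfms (A \<^bold>\<cdot> B) = insert (A \<^bold>\<cdot> B) (subfms A \<union> subfms B)"
| "subfms (A \<^bold>/ B) = insert (A \<^bold>/ B) (subfms A \<union> subfms B)"
| "subfms (A \<^bold>\<setminus>\<^bold>\<setminus> B) = insert (A \<^bold>\<setminus>\<^bold>\<setminus> B) (subfms A \<union> subfms B)"
| "subfms (A \<^bold>/\<^bold>/ B) = insert (A \<^bold>/\<^bold>/ B) (subfms A \<union> subfms B)"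
| "subfms (A \<^bold>\<and> B) = insert (A \<^bold>\<and> B) (subfms A \<union> subfms B)"
| "subfms (A \<^bold>\<or> B) = insert (A \<^bold>\<or> B) (subfms A \<union> subfms B)"

lemma finite_subfms: "finite (subfms A)"
  by (induction A) auto

lemma subfms_refl: "A \<in> subfms A"
  by (cases A) auto

lemma subfms_trans: "B \<in> subfms A \<Longrightarrow> subfms B \<subseteq> subfms A"
  by (induction A) auto

text \<open>The states live in an arbitrary type and are labelled by worlds, so that the model can be
  realised in any type with sufficiently many elements.\<close>

locale canonical =
  fixes G :: "'p fm set" and S :: "'s set" and g :: "'s \<Rightarrow> 'p fm set"
  assumes finite_G: "finite G"
    and closed_G: "E \<in> G \<Longrightarrow> subfms E \<subseteq> G"
    and labels: "g ` S = worlds G"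
begin

text \<open>The usual condition, that \<open>A\<close> in \<open>t\<close> and \<open>B\<close> in
  \<open>u\<close> put their product into \<open>v\<close>, is too weak here because the product may
  lie outside \<open>G\<close>. The underivable sequent replaces it.\<close>

definition R :: "('s \<times> 's \<times> 's) set" where
  "R = {(t, u, v). t \<in> S \<and> u \<in> S \<and> v \<in> S \<and>
     \<not> meet (g t) \<^bold>\<cdot> meet (g u) \<turnstile> join (G - g v)}"

definition V :: "'p \<Rightarrow> 's set" where
  "V p = {s \<in> S. Var p \<in> g s}"

lemma R_in_S: "(t, u, v) \<in> R \<Longrightarrow> t \<in> S \<and> u \<in> S \<and> v \<in> S"
  unfolding R_def by simp

lemma frame: "S \<noteq> {} \<Longrightarrow> dosen_frame S R"
  unfolding dosen_frame_def R_def by auto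

lemma model: "S \<noteq> {} \<Longrightarrow> dosen_model S R V"
  unfolding dosen_model_def V_def using frame by auto

lemma derives_iff_mem: "s \<in> S \<Longrightarrow> E \<in> G \<Longrightarrow> meet (g s) \<turnstile> E \<longleftrightarrow> E \<in> g s"
  using labels finite_G by (intro meet_derives_iff_mem) auto

lemma separating_state:
  assumes "\<not> C \<turnstile> D"
  obtains s where "s \<in> S" "\<not> C \<turnstile> join (G - g s)" "\<not> meet (g s) \<turnstile> D"
    "\<And>E. E \<in> G \<Longrightarrow> C \<turnstile> E \<Longrightarrow> E \<in> g s"
proof -
  obtain t where t: "t \<in> worlds G" "\<not> C \<turnstile> join (G - t)" "\<not> meet t \<turnstile> D"
    using separating_world[OF finite_G assms] .
  then have "t \<in> g ` S" using labels by simp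
  then obtain s where s: "s \<in> S" "g s = t" by auto
  have "E \<in> t" if "E \<in> G" "C \<turnstile> E" for E
    using mem_if_not_derives_join[OF finite_G that(1)] cut[OF that(2)] t(2) by blast
  then show ?thesis using t s that[of s] by simp
qed

text \<open>If \<open>C\<close> were missing from \<open>g v\<close>, it would derive
  \<open>join (G - g v)\<close>, and so would the product of the two meets. This gives the direction
  from membership to the relational condition for every division.\<close>

lemma R_mem:
  assumes "(t, u, v) \<in> R" "meet (g t) \<turnstile> A" "meet (g u) \<turnstile> B" "A \<^bold>\<cdot> B \<turnstile> C" "C \<in> G"
  shows "C \<in> g v"
proof (rule mem_if_not_derives_join[OF finite_G assms(5)])
  have "meet (g t) \<^bold>\<cdot> meet (g u) \<turnstile> C" using cut[OF Prod_mono[OF assms(2,3)] assms(4)] .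
  then show "\<not> C \<turnstile> join (G - g v)" using assms(1) cut[of _ C] unfolding R_def by blast
qed

text \<open>Residuation leaves \<open>A\<close> alone on the left. A state separating it from the
  quotient is related as required once residuation is undone.\<close>

lemma R_left_witness:
  assumes "u \<in> S" "v \<in> S" "A \<in> G" "\<not> A \<^bold>\<cdot> meet (g u) \<turnstile> join (G - g v)"
  obtains t where "(t, u, v) \<in> R" "A \<in> g t"
proof -
  have "\<not> A \<turnstile> join (G - g v) \<^bold>/ meet (g u)" using assms(4) by (simp add: derives_RDiv_iff)
  then obtain t where t: "t \<in> S" "\<not> meet (g t) \<turnstile> join (G - g v) \<^bold>/ meet (g u)" "A \<in> g t"
    by (rule separating_state) (use assms(3) ax_id in blast)
  then show ?thesis using that[of t] assms by (simp add: R_def derives_RDiv_iff)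
qed

lemma R_right_witness:
  assumes "t \<in> S" "v \<in> S" "A \<in> G" "\<not> meet (g t) \<^bold>\<cdot> A \<turnstile> join (G - g v)"
  obtains u where "(t, u, v) \<in> R" "A \<in> g u"
proof -
  have "\<not> A \<turnstile> meet (g t) \<^bold>\<setminus> join (G - g v)" using assms(4) by (simp add: derives_LDiv_iff)
  then obtain u where u: "u \<in> S" "\<not> meet (g u) \<turnstile> meet (g t) \<^bold>\<setminus> join (G - g v)" "A \<in> g u"
    by (rule separating_state) (use assms(3) ax_id in blast)
  then show ?thesis using that[of u] assms by (simp add: R_def derives_LDiv_iff)
qed

section \<open>Membership conditions for products and divisions\<close>

lemma Prod_mem_iff:
  assumes "s \<in> S" "A \<^bold>\<cdot> B \<in> G" "A \<in> G" "B \<in> G"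
  shows "A \<^bold>\<cdot> B \<in> g s \<longleftrightarrow> (\<exists>t\<in>S. \<exists>u\<in>S. (t, u, s) \<in> R \<and> A \<in> g t \<and> B \<in> g u)"
proof
  assume "A \<^bold>\<cdot> B \<in> g s"
  then have "meet (g s) \<turnstile> A \<^bold>\<cdot> B" using derives_iff_mem assms by blast
  moreover have "\<not> meet (g s) \<turnstile> join (G - g s)"
    using assms(1) labels by (auto simp: worlds_def)
  ultimately have "\<not> A \<^bold>\<cdot> B \<turnstile> join (G - g s)" using cut[of "meet (g s)" "A \<^bold>\<cdot> B"] by blast
  \<comment> \<open>The factors are replaced by states one after the other: first \<open>A\<close>
    by \<open>t\<close>, with \<open>B\<close> kept as a formula, then \<open>B\<close> by
    \<open>u\<close>.\<close>
  then have "\<not> A \<turnstile> join (G - g s) \<^bold>/ B" by (simp add: derives_RDiv_iff)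
  then obtain t where t: "t \<in> S" "\<not> meet (g t) \<turnstile> join (G - g s) \<^bold>/ B" "A \<in> g t"
    by (rule separating_state) (use assms(3) ax_id in blast)
  then have "\<not> meet (g t) \<^bold>\<cdot> B \<turnstile> join (G - g s)" by (simp add: derives_RDiv_iff)
  then obtain u where "(t, u, s) \<in> R" "B \<in> g u"
    using R_right_witness[OF t(1) assms(1,4)] by blast
  then show "\<exists>t\<in>S. \<exists>u\<in>S. (t, u, s) \<in> R \<and> A \<in> g t \<and> B \<in> g u"
    using t R_in_S by blast
next
  assume "\<exists>t\<in>S. \<exists>u\<in>S. (t, u, s) \<in> R \<and> A \<in> g t \<and> B \<in> g u"
  then obtain t u where tu: "(t, u, s) \<in> R" "A \<in> g t" "B \<in> g u" by blast
  then have "meet (g t) \<turnstile> A" "meet (g u) \<turnstile> B"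
    using derives_iff_mem assms(3,4) R_in_S[OF tu(1)] by auto
  then show "A \<^bold>\<cdot> B \<in> g s" using R_mem[OF tu(1) _ _ ax_id assms(2)] by blast
qed

lemma LDiv_mem_iff:
  assumes "s \<in> S" "A \<^bold>\<setminus> B \<in> G" "A \<in> G" "B \<in> G"
  shows "A \<^bold>\<setminus> B \<in> g s \<longleftrightarrow> (\<forall>t\<in>S. \<forall>u\<in>S. (t, s, u) \<in> R \<and> A \<in> g t \<longrightarrow> B \<in> g u)"
proof
  assume *: "A \<^bold>\<setminus> B \<in> g s"
  show "\<forall>t\<in>S. \<forall>u\<in>S. (t, s, u) \<in> R \<and> A \<in> g t \<longrightarrow> B \<in> g u"
  proof (intro ballI impI)
    fix t u assume "t \<in> S" "u \<in> S" and t: "(t, s, u) \<in> R \<and> A \<in> g t"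
    then have "meet (g t) \<turnstile> A" "meet (g s) \<turnstile> A \<^bold>\<setminus> B"
      using derives_iff_mem assms(1-3) * by auto
    then show "B \<in> g u" using R_mem[OF _ _ _ resL_conv[OF ax_id] assms(4)] t by blast
  qed
next
  assume *: "\<forall>t\<in>S. \<forall>u\<in>S. (t, s, u) \<in> R \<and> A \<in> g t \<longrightarrow> B \<in> g u"
  show "A \<^bold>\<setminus> B \<in> g s"
  proof (rule ccontr)
    assume "A \<^bold>\<setminus> B \<notin> g s"
    then have "\<not> A \<^bold>\<cdot> meet (g s) \<turnstile> B" using derives_iff_mem[OF assms(1,2)] by (simp add: derives_LDiv_iff)
    \<comment> \<open>The target \<open>u\<close> is chosen first, so as to refute \<open>B\<close>;
      the left argument \<open>t\<close> is then found for this fixed \<open>u\<close>.\<close>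
    then obtain u where u: "u \<in> S" "\<not> A \<^bold>\<cdot> meet (g s) \<turnstile> join (G - g u)" "\<not> meet (g u) \<turnstile> B"
      by (rule separating_state)
    obtain t where "(t, s, u) \<in> R" "A \<in> g t"
      using R_left_witness[OF assms(1) u(1) assms(3) u(2)] .
    then have "B \<in> g u" using * R_in_S by blast
    then show False using u(1,3) derives_iff_mem assms(4) by blast
  qed
qed

lemma RDiv_mem_iff:
  assumes "s \<in> S" "B \<^bold>/ A \<in> G" "A \<in> G" "B \<in> G"
  shows "B \<^bold>/ A \<in> g s \<longleftrightarrow> (\<forall>t\<in>S. \<forall>u\<in>S. (s, t, u) \<in> R \<and> A \<in> g t \<longrightarrow> B \<in> g u)"
proof
  assume *: "B \<^bold>/ A \<in> g s"
  show "\<forall>t\<in>S. \<forall>u\<in>S. (s, t, u) \<in> R \<and> A \<in> g t \<longrightarrow> B \<in> g u"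
  proof (intro ballI impI)
    fix t u assume "t \<in> S" "u \<in> S" and t: "(s, t, u) \<in> R \<and> A \<in> g t"
    then have "meet (g s) \<turnstile> B \<^bold>/ A" "meet (g t) \<turnstile> A"
      using derives_iff_mem assms(1-3) * by auto
    then show "B \<in> g u" using R_mem[OF _ _ _ resR_conv[OF ax_id] assms(4)] t by blast
  qed
next
  assume *: "\<forall>t\<in>S. \<forall>u\<in>S. (s, t, u) \<in> R \<and> A \<in> g t \<longrightarrow> B \<in> g u"
  show "B \<^bold>/ A \<in> g s"
  proof (rule ccontr)
    assume "B \<^bold>/ A \<notin> g s"
    then have "\<not> meet (g s) \<^bold>\<cdot> A \<turnstile> B" using derives_iff_mem[OF assms(1,2)] by (simp add: derives_RDiv_iff)
    then obtain u where u: "u \<in> S" "\<not> meet (g s) \<^bold>\<cdot> A \<turnstile> join (G - g u)" "\<not> meet (g u) \<turnstile> B"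
      by (rule separating_state)
    obtain t where "(s, t, u) \<in> R" "A \<in> g t"
      using R_right_witness[OF assms(1) u(1) assms(3) u(2)] .
    then have "B \<in> g u" using * R_in_S by blast
    then show False using u(1,3) derives_iff_mem assms(4) by blast
  qed
qed

text \<open>This is the closure condition for coinduction on the set of states whose label contains
  the iterated division.\<close>

lemma ItLDiv_mem_step:
  assumes "(t, s, u) \<in> R" "A \<in> g t" "A \<^bold>\<setminus>\<^bold>\<setminus> B \<in> g s" "A \<^bold>\<setminus>\<^bold>\<setminus> B \<in> G" "A \<in> G" "B \<in> G"
  shows "A \<^bold>\<setminus>\<^bold>\<setminus> B \<in> g u \<and> B \<in> g u"
proof
  have t: "meet (g t) \<turnstile> A" "meet (g s) \<turnstile> A \<^bold>\<setminus>\<^bold>\<setminus> B"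
    using derives_iff_mem assms R_in_S[OF assms(1)] by auto
  have "A \<^bold>\<cdot> (A \<^bold>\<setminus>\<^bold>\<setminus> B) \<turnstile> A \<^bold>\<setminus>\<^bold>\<setminus> B" "A \<^bold>\<cdot> (A \<^bold>\<setminus>\<^bold>\<setminus> B) \<turnstile> B"
    by (rule resL_conv, rule cut[OF itL_unfold], rule ax_conj2 ax_conj1)+
  then show "A \<^bold>\<setminus>\<^bold>\<setminus> B \<in> g u" "B \<in> g u"
    using R_mem[OF assms(1) t] assms(4,6) by auto
qed

lemma ItRDiv_mem_step:
  assumes "(s, t, u) \<in> R" "A \<in> g t" "B \<^bold>/\<^bold>/ A \<in> g s" "B \<^bold>/\<^bold>/ A \<in> G" "A \<in> G" "B \<in> G"
  shows "B \<^bold>/\<^bold>/ A \<in> g u \<and> B \<in> g u"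
proof
  have t: "meet (g s) \<turnstile> B \<^bold>/\<^bold>/ A" "meet (g t) \<turnstile> A"
    using derives_iff_mem assms R_in_S[OF assms(1)] by auto
  have "(B \<^bold>/\<^bold>/ A) \<^bold>\<cdot> A \<turnstile> B \<^bold>/\<^bold>/ A" "(B \<^bold>/\<^bold>/ A) \<^bold>\<cdot> A \<turnstile> B"
    by (rule resR_conv, rule cut[OF itR_unfold], rule ax_conj2 ax_conj1)+
  then show "B \<^bold>/\<^bold>/ A \<in> g u" "B \<in> g u"
    using R_mem[OF assms(1) t] assms(4,6) by auto
qed

section \<open>Describing sets of states by formulas\<close>

definition describe :: "'s set \<Rightarrow> 'p fm" where
  "describe X = join (meet ` g ` X)"

lemma describe_derives_iff:
  assumes "X \<subseteq> S"
  shows "describe X \<turnstile> D \<longleftrightarrow> (\<forall>s\<in>X. meet (g s) \<turnstile> D)"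
proof -
  \<comment> \<open>\<open>X\<close> itself may be infinite, since \<open>g\<close> need not be
    injective; only the labels enter the join.\<close>
  have "finite (g ` X)"
    using assms labels finite_worlds[OF finite_G] by (metis finite_subset image_mono)
  then show ?thesis unfolding describe_def by (simp add: join_derives_iff)
qed

text \<open>A state \<open>v\<close> refuting the sequent would be reached by a step along
  \<open>A\<close> from some \<open>s\<close> in \<open>X\<close>: separation yields
  \<open>v\<close>, the join in \<open>describe X\<close> yields \<open>s\<close>, and a witness for
  \<open>A\<close> yields \<open>t\<close>. Then \<open>v\<close> lies in \<open>X\<close> and
  contains \<open>B\<close>, so it cannot refute the right-hand side.\<close>

lemma describe_step_left:
  assumes "X \<subseteq> S" "A \<in> G" "B \<in> G"
    and step: "\<And>t s u. (t, s, u) \<in> R \<Longrightarrow> A \<in> g t \<Longrightarrow> s \<in> X \<Longrightarrow> u \<in> X \<and> B \<in> g u"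
  shows "A \<^bold>\<cdot> describe X \<turnstile> describe X \<^bold>\<and> B"
proof (rule ccontr)
  assume "\<not> ?thesis"
  then obtain v where v: "v \<in> S" "\<not> A \<^bold>\<cdot> describe X \<turnstile> join (G - g v)"
      "\<not> meet (g v) \<turnstile> describe X \<^bold>\<and> B"
    by (rule separating_state)
  then have "\<not> describe X \<turnstile> A \<^bold>\<setminus> join (G - g v)" by (simp add: derives_LDiv_iff)
  then obtain s where s: "s \<in> X" "\<not> meet (g s) \<turnstile> A \<^bold>\<setminus> join (G - g v)"
    using describe_derives_iff[OF assms(1)] by blast
  then have "\<not> A \<^bold>\<cdot> meet (g s) \<turnstile> join (G - g v)" by (simp add: derives_LDiv_iff)
  then obtain t where "(t, s, v) \<in> R" "A \<in> g t"
    using R_left_witness[OF _ v(1) assms(2)] s(1) assms(1) by blast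
  then have "v \<in> X" "B \<in> g v" using step s(1) by auto
  then have "meet (g v) \<turnstile> describe X" "meet (g v) \<turnstile> B"
    using describe_derives_iff[OF assms(1), of "describe X"] ax_id derives_iff_mem v(1) assms(3) by auto
  then show False using v(3) by (simp add: derives_Conj_iff)
qed

lemma describe_step_right:
  assumes "X \<subseteq> S" "A \<in> G" "B \<in> G"
    and step: "\<And>t s u. (s, t, u) \<in> R \<Longrightarrow> A \<in> g t \<Longrightarrow> s \<in> X \<Longrightarrow> u \<in> X \<and> B \<in> g u"
  shows "describe X \<^bold>\<cdot> A \<turnstile> describe X \<^bold>\<and> B"
proof (rule ccontr)
  assume "\<not> ?thesis"
  then obtain v where v: "v \<in> S" "\<not> describe X \<^bold>\<cdot> A \<turnstile> join (G - g v)"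
      "\<not> meet (g v) \<turnstile> describe X \<^bold>\<and> B"
    by (rule separating_state)
  then have "\<not> describe X \<turnstile> join (G - g v) \<^bold>/ A" by (simp add: derives_RDiv_iff)
  then obtain s where s: "s \<in> X" "\<not> meet (g s) \<turnstile> join (G - g v) \<^bold>/ A"
    using describe_derives_iff[OF assms(1)] by blast
  then have "\<not> meet (g s) \<^bold>\<cdot> A \<turnstile> join (G - g v)" by (simp add: derives_RDiv_iff)
  then obtain t where "(s, t, v) \<in> R" "A \<in> g t"
    using R_right_witness[OF _ v(1) assms(2)] s(1) assms(1) by blast
  then have "v \<in> X" "B \<in> g v" using step s(1) by auto
  then have "meet (g v) \<turnstile> describe X" "meet (g v) \<turnstile> B"
    using describe_derives_iff[OF assms(1), of "describe X"] ax_id derives_iff_mem v(1) assms(3) by auto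
  then show False using v(3) by (simp add: derives_Conj_iff)
qed

lemma truth: "E \<in> G \<Longrightarrow> s \<in> S \<Longrightarrow> sat S R V s E \<longleftrightarrow> E \<in> g s"
proof (induction E arbitrary: s)
  case (Var p)
  then show ?case by (simp add: V_def)
next
  case Top
  then show ?case using derives_iff_mem ax_top by auto
next
  case Bot
  have "\<not> meet (g s) \<turnstile> join (G - g s)"
    using Bot labels by (auto simp: worlds_def)
  then have "Bot \<notin> g s" using Bot derives_iff_mem[of s Bot] cut[OF _ ax_bot] by blast
  then show ?case by simp
next
  case (LDiv A B)
  have "A \<in> G" "B \<in> G" using closed_G[OF LDiv.prems(1)] subfms_refl by auto
  \<comment> \<open>The congruence rule makes membership in \<open>S\<close> available under the
    bounded quantifiers, as the induction hypotheses require.\<close>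
  then show ?case using LDiv by (simp add: LDiv_mem_iff cong: ball_cong_simp)
next
  case (Prod A B)
  have "A \<in> G" "B \<in> G" using closed_G[OF Prod.prems(1)] subfms_refl by auto
  then show ?case using Prod by (simp add: Prod_mem_iff cong: bex_cong_simp)
next
  case (RDiv B A)
  have "A \<in> G" "B \<in> G" using closed_G[OF RDiv.prems(1)] subfms_refl by auto
  then show ?case using RDiv by (simp add: RDiv_mem_iff cong: ball_cong_simp)
next
  case (ItLDiv A B)
  have G: "A \<in> G" "B \<in> G" using closed_G[OF ItLDiv.prems(1)] subfms_refl by auto
  have frame: "dosen_frame S R" using ItLDiv.prems(2) by (intro frame) auto
  \<comment> \<open>The set is defined by satisfaction, so its closure under steps comes from the
    semantic unfolding; only \<open>A\<close> and \<open>B\<close> are translated into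
    membership.\<close>
  let ?X = "{s \<in> S. sat S R V s (A \<^bold>\<setminus>\<^bold>\<setminus> B)}"
  show ?case
  proof
    assume "sat S R V s (A \<^bold>\<setminus>\<^bold>\<setminus> B)"
    have "A \<^bold>\<cdot> describe ?X \<turnstile> describe ?X \<^bold>\<and> B"
    proof (rule describe_step_left[OF _ G])
      fix t s u assume r: "(t, s, u) \<in> R" and t: "A \<in> g t" and "s \<in> ?X"
      then have "\<forall>t u. (t, s, u) \<in> R \<longrightarrow> sat S R V t A \<longrightarrow>
          sat S R V u B \<and> sat S R V u (A \<^bold>\<setminus>\<^bold>\<setminus> B)"
        using sat_ItLDiv_unfold[OF frame, of s V A B] by blast
      then show "u \<in> ?X \<and> B \<in> g u"
        using r t R_in_S[OF r] ItLDiv.IH G by blast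
    qed blast
    then have "describe ?X \<turnstile> A \<^bold>\<setminus>\<^bold>\<setminus> B" by (rule itL_intro)
    moreover have "s \<in> ?X" using \<open>sat S R V s (A \<^bold>\<setminus>\<^bold>\<setminus> B)\<close> ItLDiv.prems(2) by blast
    ultimately have "meet (g s) \<turnstile> A \<^bold>\<setminus>\<^bold>\<setminus> B"
      using describe_derives_iff[of ?X] by blast
    then show "A \<^bold>\<setminus>\<^bold>\<setminus> B \<in> g s" using derives_iff_mem ItLDiv.prems by blast
  next
    assume "A \<^bold>\<setminus>\<^bold>\<setminus> B \<in> g s"
    then show "sat S R V s (A \<^bold>\<setminus>\<^bold>\<setminus> B)"
    \<comment> \<open>In this direction the invariant is defined by membership instead, and the
      unfold axiom closes it under steps.\<close>
    proof (intro sat_ItLDiv_coinduct[of s "{s. A \<^bold>\<setminus>\<^bold>\<setminus> B \<in> g s}"])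
      fix t s' u
      assume r: "(t, s', u) \<in> R" and s': "s' \<in> {s. A \<^bold>\<setminus>\<^bold>\<setminus> B \<in> g s}" and t: "sat S R V t A"
      have "A \<in> g t" using ItLDiv.IH t R_in_S[OF r] G by simp
      then have "A \<^bold>\<setminus>\<^bold>\<setminus> B \<in> g u" "B \<in> g u"
        using ItLDiv_mem_step[OF r] s' ItLDiv.prems(1) G by auto
      then show "u \<in> {s. A \<^bold>\<setminus>\<^bold>\<setminus> B \<in> g s} \<and> sat S R V u B"
        using ItLDiv.IH R_in_S[OF r] G by simp
    qed simp
  qed
next
  case (ItRDiv B A)
  have G: "A \<in> G" "B \<in> G" using closed_G[OF ItRDiv.prems(1)] subfms_refl by auto
  have frame: "dosen_frame S R" using ItRDiv.prems(2) by (intro frame) auto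
  let ?X = "{s \<in> S. sat S R V s (B \<^bold>/\<^bold>/ A)}"
  show ?case
  proof
    assume "sat S R V s (B \<^bold>/\<^bold>/ A)"
    have "describe ?X \<^bold>\<cdot> A \<turnstile> describe ?X \<^bold>\<and> B"
    proof (rule describe_step_right[OF _ G])
      fix t s u assume r: "(s, t, u) \<in> R" and t: "A \<in> g t" and "s \<in> ?X"
      then have "\<forall>t u. (s, t, u) \<in> R \<longrightarrow> sat S R V t A \<longrightarrow>
          sat S R V u B \<and> sat S R V u (B \<^bold>/\<^bold>/ A)"
        using sat_ItRDiv_unfold[OF frame, of s V B A] by blast
      then show "u \<in> ?X \<and> B \<in> g u"
        using r t R_in_S[OF r] ItRDiv.IH G by blast
    qed blast
    then have "describe ?X \<turnstile> B \<^bold>/\<^bold>/ A" by (rule itR_intro)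
    moreover have "s \<in> ?X" using \<open>sat S R V s (B \<^bold>/\<^bold>/ A)\<close> ItRDiv.prems(2) by blast
    ultimately have "meet (g s) \<turnstile> B \<^bold>/\<^bold>/ A"
      using describe_derives_iff[of ?X] by blast
    then show "B \<^bold>/\<^bold>/ A \<in> g s" using derives_iff_mem ItRDiv.prems by blast
  next
    assume "B \<^bold>/\<^bold>/ A \<in> g s"
    then show "sat S R V s (B \<^bold>/\<^bold>/ A)"
    proof (intro sat_ItRDiv_coinduct[of s "{s. B \<^bold>/\<^bold>/ A \<in> g s}"])
      fix t s' u
      assume r: "(s', t, u) \<in> R" and s': "s' \<in> {s. B \<^bold>/\<^bold>/ A \<in> g s}" and t: "sat S R V t A"
      have "A \<in> g t" using ItRDiv.IH t R_in_S[OF r] G by simp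
      then have "B \<^bold>/\<^bold>/ A \<in> g u" "B \<in> g u"
        using ItRDiv_mem_step[OF r] s' ItRDiv.prems(1) G by auto
      then show "u \<in> {s. B \<^bold>/\<^bold>/ A \<in> g s} \<and> sat S R V u B"
        using ItRDiv.IH R_in_S[OF r] G by simp
    qed simp
  qed
next
  case (Conj A B)
  have G: "A \<in> G" "B \<in> G" using closed_G[OF Conj.prems(1)] subfms_refl by auto
  show ?case
    using Conj G derives_iff_mem[of s] derives_Conj_iff[of "meet (g s)" A B] by simp
next
  case (Disj A B)
  have G: "A \<in> G" "B \<in> G" using closed_G[OF Disj.prems(1)] subfms_refl by auto
  have *: "\<not> meet (g s) \<turnstile> join (G - g s)"
    using Disj.prems(2) labels by (auto simp: worlds_def)
  have "A \<in> g s \<or> B \<in> g s" if "meet (g s) \<turnstile> A \<^bold>\<or> B"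
  proof (rule ccontr)
    assume "\<not> (A \<in> g s \<or> B \<in> g s)"
    \<comment> \<open>Worlds are prime: two disjuncts missing from the label both lie in
      \<open>G - g s\<close>, so the disjunction would derive its join.\<close>
    then have "A \<^bold>\<or> B \<turnstile> join (G - g s)"
      using G finite_G by (intro disjL derives_join) auto
    then show False using * cut[OF that] by blast
  qed
  moreover have "meet (g s) \<turnstile> A \<Longrightarrow> meet (g s) \<turnstile> A \<^bold>\<or> B" "meet (g s) \<turnstile> B \<Longrightarrow> meet (g s) \<turnstile> A \<^bold>\<or> B"
    by (erule cut, rule ax_disj1 ax_disj2)+
  ultimately show ?case using Disj G derives_iff_mem by auto
qed

end

section \<open>Weak completeness over an infinite state type\<close>

lemma completeness:
  assumes inf: "infinite (UNIV :: 's set)"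
    and valid: "\<And>(S :: 's set) R. dosen_frame S R \<Longrightarrow> valid_in S R A B"
  shows "A \<turnstile> B"
proof (rule ccontr)
  assume neg: "\<not> A \<turnstile> B"
  define G where "G = subfms A \<union> subfms B"
  have fin: "finite G" unfolding G_def by (simp add: finite_subfms)
  \<comment> \<open>Worlds are sets of formulas, whereas the frames range over the type
    \<open>'s\<close>. The finitely many worlds are embedded there; their number depends on
    \<open>A\<close> and \<open>B\<close>, and an infinite type has room for all cases.\<close>
  obtain f :: "'a fm set \<Rightarrow> 's" where f: "inj_on f (worlds G)"
  proof -
    obtain T :: "'s set" where "finite T" "card T = card (worlds G)"
      using infinite_arbitrarily_large[OF inf] by blast
    then show ?thesis
      using finite_same_card_bij[OF finite_worlds[OF fin]] that bij_betw_imp_inj_on by metis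
  qed
  \<comment> \<open>The states are the images of the worlds under \<open>f\<close>, and the label of
    a state is the world it came from.\<close>
  interpret canonical G "f ` worlds G" "inv_into (worlds G) f"
  proof
    show "subfms E \<subseteq> G" if "E \<in> G" for E
      using that subfms_trans unfolding G_def by blast
    show "inv_into (worlds G) f ` f ` worlds G = worlds G"
      using f by simp
  qed (rule fin)
  have AB: "A \<in> G" "B \<in> G" unfolding G_def using subfms_refl by auto
  obtain s where s: "s \<in> f ` worlds G" "\<not> meet (inv_into (worlds G) f s) \<turnstile> B"
      "A \<in> inv_into (worlds G) f s"
    using neg by (rule separating_state) (use AB(1) ax_id in blast)
  then have "dosen_frame (f ` worlds G) R" "dosen_model (f ` worlds G) R V"
    using frame model by auto
  then have "sat (f ` worlds G) R V s A \<longrightarrow> sat (f ` worlds G) R V s B"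
    using valid s(1) unfolding valid_in_def by blast
  then show False
    using truth[OF AB(1) s(1)] truth[OF AB(2) s(1)] s derives_iff_mem[OF s(1) AB(2)] by simp
qed

theorem theorem1:
  fixes A B :: "'p fm"
  assumes "infinite (UNIV :: 's set)"
  shows "A \<turnstile> B \<longleftrightarrow>
    (\<forall>(S :: 's set) R. dosen_frame S R \<longrightarrow> valid_in S R A B)"
proof
  assume "A \<turnstile> B"
  then show "\<forall>(S :: 's set) R. dosen_frame S R \<longrightarrow> valid_in S R A B"
    unfolding valid_in_def by (auto intro: soundness)
next
  assume "\<forall>(S :: 's set) R. dosen_frame S R \<longrightarrow> valid_in S R A B"
  then show "A \<turnstile> B" by (intro completeness[OF assms]) simp
qed

end
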